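(* Let $W$ be the set of states of a world containing an agent with action set $A$, and let $\sim$ be the equivalence relation on $A$ given by $a\sim a'$ iff $a*w=a'*w$ for all $w\in W$. Suppose that (1) (unrestricted actions) $a*w$ is defined for all $a\in A$ and all $w\in W$; and (2) (inverse actions) for each $a\in A/\sim$ there exists $a'\in A/\sim$ such that $(a'\circ a)*w=w$ and $(a\circ a')*w=w$ for all $w\in W$. Then $(A/\sim,\circ)$ is a group.
   Context: A world is a directed multigraph $(W,\hat D,s,t)$ with vertex set $W$ (world states), arrow set $\hat D$ and source and target maps $s,t:\hat D\to W$; for each $w\in W$ there is a distinguished trivial arrow $1_w\in\hat D$ with $s(1_w)=t(1_w)=w$. $D$ is the set of all paths $\hat d_n\circ\cdots\circ\hat d_1$ ($n\ge 1$, $t(\hat d_i)=s(\hat d_{i+1})$), with $s,t$ extended to paths by taking the source of the first arrow and the target of the last. Agent and actions. There is a set $\hat A$ (minimum actions); $A$ is the set of all nonempty finite sequences of elements of $\hat A$, and $\circ$ on $A$ is concatenation, with $a'\circ a$ meaning "first $a$, then $a'$". There is a subset $\hat D_A\subset D$ (minimum action transitions) with $1_w\in\hat D_A$ for all $w\in W$, and a labelling map $\hat l:\hat D_A\to\hat A$ such that: (i) if $d\ne d'$ in $\hat D_A$ have $s(d)=s(d')$ then $\hat l(d)\neq\hat l(d')$; (ii) there is an element $1\in\hat A$ (the identity action) with $\hat l(1_w)=1$ for all $w\in W$. $D_A$ is the set of all nonempty paths in the multigraph with vertices $W$ and arrows $\hat D_A$; the labelling extends to $l:D_A\to A$ by $l(d_n\circ\cdots\circ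 d_1)=\hat l(d_n)\cdots\hat l(d_1)$. Standing assumption: every world state transition is due to the agent, i.e. $D=D_A$ (every path in $D$ is a composite of minimum action transitions). Effect of actions. For $a\in A$, $w\in W$: if there is $d\in D_A$ with $s(d)=w$ and $l(d)=a$, then $a*w=t(d)$ (unambiguous by (i)); otherwise $a*w$ is undefined. The equality $a*w=a'*w$ means that either both sides are undefined, or both are defined and equal. $[a]_\sim$ denotes the class of $a$; composition on $A/\sim$ is the (well-defined) operation $[a']_\sim\circ[a]_\sim=[a'\circ a]_\sim$, and the effect of a class on a state is $[a]_\sim*w=a*w$ (undefined if $a*w$ is undefined). *)

theory Defs
  imports "Graph_Theory.Arc_Walk" "HOL-Algebra.Group"
begin

section \<open>Worlds\<close>

text \<open>
  A path \<open>d\<^sub>n \<circ> \<dots> \<circ> d\<^sub>1\<close> is the list \<open>[d\<^sub>1, \<dots>, d\<^sub>n]\<close> of its arrows in the order in which they are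
  traversed.
\<close>

definition paths :: "('v, 'e) pre_digraph \<Rightarrow> 'e list set" where
  "paths G = {p. p \<noteq> [] \<and> (\<exists>u v. pre_digraph.awalk G u p v)}"

definition path_src :: "('v, 'e) pre_digraph \<Rightarrow> 'e list \<Rightarrow> 'v" where
  "path_src G p = tail G (hd p)"

definition path_tgt :: "('v, 'e) pre_digraph \<Rightarrow> 'e list \<Rightarrow> 'v" where
  "path_tgt G p = head G (last p)"

locale world = wf_digraph G for G :: "('w, 'd) pre_digraph" +
  fixes triv :: "'w \<Rightarrow> 'd"
  assumes triv_in_arcs: "w \<in> verts G \<Longrightarrow> triv w \<in> arcs G"
    and tail_triv: "w \<in> verts G \<Longrightarrow> tail G (triv w) = w"
    and head_triv: "w \<in> verts G \<Longrightarrow> head G (triv w) = w"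


section \<open>Worlds with an agent\<close>

record ('w, 'd, 'a) agent_world =
  graph :: "('w, 'd) pre_digraph"
  trivial_arrow :: "'w \<Rightarrow> 'd"
  min_actions :: "'a set"
  min_transitions :: "'d list set"
  min_label :: "'d list \<Rightarrow> 'a"
  identity_action :: 'a

abbreviation states :: "('w, 'd, 'a) agent_world \<Rightarrow> 'w set" where
  "states M \<equiv> verts (graph M)"

text \<open>
  The multigraph whose arrows are the minimum action transitions. A path in it is a list of
  lists: it remembers its decomposition into minimum action transitions, on which the label
  of the path depends. Its image under \<^const>\<open>concat\<close> is the composite path of the world.
\<close>

definition action_graph :: "('w, 'd, 'a) agent_world \<Rightarrow> ('w, 'd list) pre_digraph" where
  "action_graph M = \<lparr>verts = states M, arcs = min_transitions M,
     tail = path_src (graph M), head = path_tgt (graph M)\<rparr>"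

abbreviation action_paths :: "('w, 'd, 'a) agent_world \<Rightarrow> 'd list list set" where
  "action_paths M \<equiv> paths (action_graph M)"

locale agent_world = world "graph M" "trivial_arrow M" for M :: "('w, 'd, 'a) agent_world" +
  assumes min_transitions_subset: "min_transitions M \<subseteq> paths (graph M)"
    and triv_min_transition: "w \<in> states M \<Longrightarrow> [trivial_arrow M w] \<in> min_transitions M"
    and min_label_closed: "p \<in> min_transitions M \<Longrightarrow> min_label M p \<in> min_actions M"
    and min_label_distinct:
      "\<lbrakk>p \<in> min_transitions M; q \<in> min_transitions M; p \<noteq> q;
        path_src (graph M) p = path_src (graph M) q\<rbrakk> \<Longrightarrow> min_label M p \<noteq> min_label M q"
    and identity_action_closed: "identity_action M \<in> min_actions M"
    and min_label_triv: "w \<in> states M \<Longrightarrow> min_label M [trivial_arrow M w] = identity_action M"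
    and all_transitions_due_to_agent: "concat ` action_paths M = paths (graph M)"


section \<open>Actions and their effect\<close>

text \<open>
  Like paths, actions are listed in the order in which they are performed, so that
  \<open>a' \<circ> a\<close> (first \<open>a\<close>, then \<open>a'\<close>) is the list \<open>a @ a'\<close>, and the label of a path is obtained
  arrow by arrow.
\<close>

definition actions :: "('w, 'd, 'a) agent_world \<Rightarrow> 'a list set" where
  "actions M = {a. a \<noteq> [] \<and> set a \<subseteq> min_actions M}"

definition act_comp :: "'a list \<Rightarrow> 'a list \<Rightarrow> 'a list" where
  "act_comp a' a = a @ a'"

definition path_label :: "('w, 'd, 'a) agent_world \<Rightarrow> 'd list list \<Rightarrow> 'a list" where
  "path_label M p = map (min_label M) p"

definition effect :: "('w, 'd, 'a) agent_world \<Rightarrow> 'a list \<Rightarrow> 'w \<Rightarrow> 'w option" where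
  "effect M a w =
    (if \<exists>p\<in>action_paths M. path_src (action_graph M) p = w \<and> path_label M p = a
     then Some (THE v. \<exists>p\<in>action_paths M. path_src (action_graph M) p = w \<and>
       path_label M p = a \<and> path_tgt (action_graph M) p = v)
     else None)"

definition act_equiv :: "('w, 'd, 'a) agent_world \<Rightarrow> ('a list \<times> 'a list) set" where
  "act_equiv M = {(a, a'). a \<in> actions M \<and> a' \<in> actions M \<and>
     (\<forall>w\<in>states M. effect M a w = effect M a' w)}"

definition action_classes :: "('w, 'd, 'a) agent_world \<Rightarrow> 'a list set set" where
  "action_classes M = actions M // act_equiv M"

text \<open>
  The operations on classes are given by representatives; see \<open>class_comp_class\<close> and
  \<open>class_effect_class\<close> below for their independence of the choice.
\<close>

definition class_comp ::
    "('w, 'd, 'a) agent_world \<Rightarrow> 'a list set \<Rightarrow> 'a list set \<Rightarrow> 'a list set" where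
  "class_comp M X' X = (\<Union>a'\<in>X'. \<Union>a\<in>X. act_equiv M `` {act_comp a' a})"

definition class_effect :: "('w, 'd, 'a) agent_world \<Rightarrow> 'a list set \<Rightarrow> 'w \<Rightarrow> 'w option" where
  "class_effect M X w = (THE r. \<exists>a\<in>X. r = effect M a w)"


section \<open>Well-definedness\<close>

lemma option_eqI: "(\<And>v. x = Some v \<longleftrightarrow> y = Some v) \<Longrightarrow> x = y"
  by (cases x; cases y) auto

lemma equiv_act_equiv: "equiv (actions M) (act_equiv M)"
  by (rule equivI) (auto simp: act_equiv_def refl_on_def sym_def trans_def)

lemma class_effect_class:
  assumes "a \<in> actions M" "w \<in> states M"
  shows "class_effect M (act_equiv M `` {a}) w = effect M a w"
  unfolding class_effect_def
  by (rule the_equality) (use assms in \<open>auto simp: act_equiv_def\<close>)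

context agent_world
begin

lemma action_graph_simps [simp]:
  "verts (action_graph M) = states M" "arcs (action_graph M) = min_transitions M"
  "tail (action_graph M) = path_src (graph M)" "head (action_graph M) = path_tgt (graph M)"
  by (simp_all add: action_graph_def)

lemma wf_digraph_action_graph: "wf_digraph (action_graph M)"
proof
  fix p assume "p \<in> arcs (action_graph M)"
  then have "p \<in> paths (graph M)" using min_transitions_subset by auto
  then have "p \<noteq> []" "set p \<subseteq> arcs (graph M)" by (auto simp: paths_def awalk_def)
  then have "hd p \<in> arcs (graph M)" "last p \<in> arcs (graph M)" by auto
  then show "tail (action_graph M) p \<in> verts (action_graph M)"
    and "head (action_graph M) p \<in> verts (action_graph M)"
    by (auto simp: path_src_def path_tgt_def)
qed

sublocale act: wf_digraph "action_graph M"
  by (rule wf_digraph_action_graph)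

lemma act_awalk_iff:
  "p \<in> action_paths M \<and> path_src (action_graph M) p = w \<and> path_tgt (action_graph M) p = v
     \<longleftrightarrow> p \<noteq> [] \<and> act.awalk w p v"
proof
  assume "p \<noteq> [] \<and> act.awalk w p v"
  then have ne: "p \<noteq> []" and aw: "act.awalk w p v" by auto
  have "act.awhd w p = w" "act.awlast w p = v" using aw by auto
  with ne aw show "p \<in> action_paths M \<and> path_src (action_graph M) p = w \<and>
      path_tgt (action_graph M) p = v"
    by (auto simp: paths_def path_src_def path_tgt_def act.awalk_verts_conv hd_append hd_map
        simp del: action_graph_simps)
next
  assume *: "p \<in> action_paths M \<and> path_src (action_graph M) p = w \<and>
    path_tgt (action_graph M) p = v"
  then obtain x y where ne: "p \<noteq> []" and aw: "act.awalk x p y" by (auto simp: paths_def)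
  have "act.awhd x p = x" "act.awlast x p = y" using aw by auto
  with * ne have "x = w" "y = v"
    by (auto simp: path_src_def path_tgt_def act.awalk_verts_conv hd_append hd_map
        simp del: action_graph_simps)
  with ne aw show "p \<noteq> [] \<and> act.awalk w p v" by simp
qed

lemma act_awalk_label_unique:
  assumes "act.awalk w p v" "act.awalk w q v'" "path_label M p = path_label M q"
  shows "p = q"
  using assms
proof (induction p arbitrary: w q)
  case Nil
  then show ?case by (simp add: path_label_def)
next
  case (Cons d p)
  then obtain d' q' where q: "q = d' # q'" by (cases q) (auto simp: path_label_def)
  have "d = d'"
    using Cons.prems min_label_distinct[of d d'] by (auto simp: q path_label_def act.awalk_Cons_iff)
  moreover have "p = q'"
    using Cons.prems by (intro Cons.IH) (auto simp: q path_label_def act.awalk_Cons_iff \<open>d = d'\<close>)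
  ultimately show ?case by (simp add: q)
qed

lemma effect_eq_Some_iff:
  "effect M a w = Some v \<longleftrightarrow> (\<exists>p. p \<noteq> [] \<and> act.awalk w p v \<and> path_label M p = a)"
    (is "_ \<longleftrightarrow> ?R v")
proof -
  have R: "(\<exists>p\<in>action_paths M. path_src (action_graph M) p = w \<and>
       path_label M p = a \<and> path_tgt (action_graph M) p = v) \<longleftrightarrow> ?R v" for v
    using act_awalk_iff[of _ w v] by blast
  have E: "(\<exists>p\<in>action_paths M. path_src (action_graph M) p = w \<and> path_label M p = a)
       \<longleftrightarrow> (\<exists>v. ?R v)"
    using R by blast
  have U: "v = v'" if "?R v" "?R v'" for v v'
  proof -
    from that obtain p q where p: "act.awalk w p v" "act.awalk w q v'"
      "path_label M p = path_label M q" by auto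
    then have "p = q" by (rule act_awalk_label_unique)
    moreover have "act.awlast w p = v" "act.awlast w q = v'" using p by auto
    ultimately show ?thesis by simp
  qed
  show ?thesis
  proof (cases "\<exists>v. ?R v")
    case True
    then obtain v' where v': "?R v'" by blast
    have "(THE v. ?R v) = v'"
      by (rule the_equality) (use v' U in blast)+
    then have "effect M a w = Some v'"
      unfolding effect_def E R if_P[OF True] by (rule arg_cong)
    moreover have "?R v \<longleftrightarrow> v' = v" using U[OF v'] v' by blast
    ultimately show ?thesis by (simp only: option.inject)
  next
    case False
    then have "effect M a w = None" unfolding effect_def E by (rule if_not_P)
    moreover have "\<not> ?R v" using False by blast
    ultimately show ?thesis by (simp only: option.distinct)
  qed
qed

lemma effect_act_comp:
  assumes "a \<noteq> []" "a' \<noteq> []"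
  shows "effect M (act_comp a' a) w = Option.bind (effect M a w) (effect M a')"
proof -
  have *: "effect M (act_comp a' a) w = Some v \<longleftrightarrow>
      (\<exists>u. effect M a w = Some u \<and> effect M a' u = Some v)" for v
  proof
    assume "effect M (act_comp a' a) w = Some v"
    then obtain p where p: "act.awalk w p v" "map (min_label M) p = a @ a'"
      unfolding effect_eq_Some_iff act_comp_def path_label_def by blast
    then obtain q r where qr: "p = q @ r" "map (min_label M) q = a" "map (min_label M) r = a'"
      unfolding map_eq_append_conv by blast
    have *: "act.awalk w q (act.awlast w q)" "act.awalk (act.awlast w q) r v"
      using p(1) unfolding qr(1) act.awalk_append_iff by blast+
    have "q \<noteq> []" "r \<noteq> []" using qr assms by auto
    then have "effect M a w = Some (act.awlast w q)" "effect M a' (act.awlast w q) = Some v"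
      unfolding effect_eq_Some_iff path_label_def using * qr by blast+
    then show "\<exists>u. effect M a w = Some u \<and> effect M a' u = Some v" by blast
  next
    assume "\<exists>u. effect M a w = Some u \<and> effect M a' u = Some v"
    then obtain u q r where "act.awalk w q u" "act.awalk u r v" "q \<noteq> []"
      "map (min_label M) q = a" "map (min_label M) r = a'"
      unfolding effect_eq_Some_iff path_label_def by blast
    then have "q @ r \<noteq> []" "act.awalk w (q @ r) v" "map (min_label M) (q @ r) = a @ a'"
      using act.awalk_appendI[of w q u r v] by simp_all
    then show "effect M (act_comp a' a) w = Some v"
      unfolding effect_eq_Some_iff act_comp_def path_label_def by blast
  qed
  have "effect M (act_comp a' a) w = Some v \<longleftrightarrow>
      Option.bind (effect M a w) (effect M a') = Some v" for v
    unfolding * by (simp add: bind_eq_Some_conv)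
  then show ?thesis
    by (rule option_eqI)
qed

lemma effect_in_states: "effect M a w = Some v \<Longrightarrow> v \<in> states M"
  unfolding effect_eq_Some_iff using act.awalk_last_in_verts by auto

lemma congruent2_act_comp:
  "congruent2 (act_equiv M) (act_equiv M) (\<lambda>a' a. act_equiv M `` {act_comp a' a})"
proof (rule congruent2I')
  fix a' b' a b
  assume *: "(a', b') \<in> act_equiv M" "(a, b) \<in> act_equiv M"
  have "(act_comp a' a, act_comp b' b) \<in> act_equiv M"
  proof -
    have A: "a \<in> actions M" "b \<in> actions M" "a' \<in> actions M" "b' \<in> actions M"
      using * by (auto simp: act_equiv_def)
    have "effect M (act_comp a' a) w = effect M (act_comp b' b) w" if "w \<in> states M" for w
    proof -
      have "effect M a w = effect M b w" using * that by (auto simp: act_equiv_def)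
      moreover have "effect M a' v = effect M b' v" if "effect M b w = Some v" for v
        using * effect_in_states[OF that] by (auto simp: act_equiv_def)
      ultimately show ?thesis
        using A by (cases "effect M b w") (auto simp: effect_act_comp actions_def)
    qed
    moreover have "act_comp a' a \<in> actions M" "act_comp b' b \<in> actions M"
      using A by (auto simp: act_comp_def actions_def)
    ultimately show ?thesis by (auto simp: act_equiv_def)
  qed
  then show "act_equiv M `` {act_comp a' a} = act_equiv M `` {act_comp b' b}"
    using equiv_class_eq_iff[OF equiv_act_equiv] by blast
qed

lemma class_comp_class:
  assumes "a' \<in> actions M" "a \<in> actions M"
  shows "class_comp M (act_equiv M `` {a'}) (act_equiv M `` {a}) = act_equiv M `` {act_comp a' a}"
  unfolding class_comp_def
  by (rule UN_equiv_class2[OF equiv_act_equiv equiv_act_equiv congruent2_act_comp assms])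

end

end

theory Submission
  imports Defs
begin

text \<open>A class of actions is determined by the partial map that it induces on the states.
  Associativity of class composition is inherited from concatenation of action lists. The class of
  the one-letter action \<open>[identity_action M]\<close> fixes every state, because the trivial
  arrow at each state carries that label; hence it is a left unit. If a composite \<open>Y\<close>
  after \<open>X\<close> fixes every state, it induces the same map as this unit and so equals it
  (\<open>action_class_eqI\<close>). Thus pointwise inverses become left inverses in the quotient,
  and a left unit with left inverses makes an associative operation a group.\<close>

context agent_world
begin

lemma act_comp_in_actions:
  "a' \<in> actions M \<Longrightarrow> a \<in> actions M \<Longrightarrow> act_comp a' a \<in> actions M"
  by (auto simp: act_comp_def actions_def)

lemma identity_in_actions: "[identity_action M] \<in> actions M"
  using identity_action_closed by (simp add: actions_def)

lemma effect_identity: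
  assumes "w \<in> states M"
  shows "effect M [identity_action M] w = Some w"
proof -
  \<comment> \<open>The inner list is the trivial arrow as a minimum action transition, the outer
    one the walk of length one along it.\<close>
  have "act.awalk w [[trivial_arrow M w]] w"
    using assms triv_min_transition
    by (simp add: act.awalk_Cons_iff act.awalk_Nil_iff path_src_def path_tgt_def
        tail_triv head_triv)
  moreover have "path_label M [[trivial_arrow M w]] = [identity_action M]"
    using assms by (simp add: path_label_def min_label_triv)
  ultimately show ?thesis
    unfolding effect_eq_Some_iff by blast
qed

lemma class_in_action_classes:
  "a \<in> actions M \<Longrightarrow> act_equiv M `` {a} \<in> action_classes M"
  unfolding action_classes_def by (rule quotientI)

lemma action_classesE:
  assumes "X \<in> action_classes M"
  obtains a where "a \<in> actions M" "X = act_equiv M `` {a}"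
  using assms unfolding action_classes_def by (rule quotientE)

text \<open>Faithfulness of the action on states: this turns pointwise statements such as the
  inverse hypothesis into equations in the quotient.\<close>

lemma action_class_eqI:
  assumes "X \<in> action_classes M" "Y \<in> action_classes M"
    and "\<And>w. w \<in> states M \<Longrightarrow> class_effect M X w = class_effect M Y w"
  shows "X = Y"
proof -
  obtain a b where a: "a \<in> actions M" "X = act_equiv M `` {a}"
    and b: "b \<in> actions M" "Y = act_equiv M `` {b}"
    using assms(1,2) by (elim action_classesE)
  have "effect M a w = effect M b w" if "w \<in> states M" for w
    using assms(3)[OF that] a b that by (simp add: class_effect_class)
  then have "(a, b) \<in> act_equiv M"
    using a b by (simp add: act_equiv_def)
  then show ?thesis
    unfolding a b by (rule equiv_class_eq[OF equiv_act_equiv])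
qed

lemma class_comp_closed:
  "X \<in> action_classes M \<Longrightarrow> Y \<in> action_classes M \<Longrightarrow> class_comp M X Y \<in> action_classes M"
  by (elim action_classesE) (simp add: class_comp_class class_in_action_classes act_comp_in_actions)

lemma class_comp_assoc:
  assumes "X \<in> action_classes M" "Y \<in> action_classes M" "Z \<in> action_classes M"
  shows "class_comp M (class_comp M X Y) Z = class_comp M X (class_comp M Y Z)"
proof -
  obtain a b c where "a \<in> actions M" "X = act_equiv M `` {a}"
    "b \<in> actions M" "Y = act_equiv M `` {b}" "c \<in> actions M" "Z = act_equiv M `` {c}"
    using assms by (elim action_classesE)
  then show ?thesis
    \<comment> \<open>\<open>act_comp\<close> stays folded until all composites are reduced to
      representatives, so that \<open>act_comp_in_actions\<close> can discharge the side
      conditions.\<close>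
    by (simp add: class_comp_class act_comp_in_actions) (simp add: act_comp_def)
qed

lemma class_comp_identity_left:
  assumes "X \<in> action_classes M"
  shows "class_comp M (act_equiv M `` {[identity_action M]}) X = X"
proof (rule action_class_eqI)
  fix w assume w: "w \<in> states M"
  obtain a where a: "a \<in> actions M" "X = act_equiv M `` {a}"
    using assms by (rule action_classesE)
  \<comment> \<open>Here \<open>a\<close> is performed first: if it is undefined at
    \<open>w\<close>, so is the composite; otherwise it ends in a state, which the identity action
    fixes.\<close>
  have "effect M (act_comp [identity_action M] a) w = effect M a w"
    using a(1) by (cases "effect M a w")
      (auto simp: effect_act_comp actions_def effect_identity effect_in_states)
  then show "class_effect M (class_comp M (act_equiv M `` {[identity_action M]}) X) w =
      class_effect M X w"
    using a w
    by (simp add: class_comp_class class_effect_class act_comp_in_actions identity_in_actions)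
qed (simp_all add: assms class_comp_closed class_in_action_classes identity_in_actions)

end

theorem proposition6:
  fixes M :: "('w, 'd, 'a) agent_world"
  assumes "agent_world M"
    and unrestricted: "\<forall>a\<in>actions M. \<forall>w\<in>states M. effect M a w \<noteq> None"
    and inverses: "\<forall>a\<in>action_classes M. \<exists>a'\<in>action_classes M. \<forall>w\<in>states M.
      class_effect M (class_comp M a' a) w = Some w \<and>
      class_effect M (class_comp M a a') w = Some w"
  shows "\<exists>e. group \<lparr>carrier = action_classes M, mult = class_comp M, one = e\<rparr>"
proof -
  interpret agent_world M by fact
  let ?e = "act_equiv M `` {[identity_action M]}"
  have e: "?e \<in> action_classes M"
    by (rule class_in_action_classes[OF identity_in_actions])
  have "\<exists>Y\<in>action_classes M. class_comp M Y X = ?e" if X: "X \<in> action_classes M" for X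
  proof -
    obtain Y where Y: "Y \<in> action_classes M"
      and inv: "\<forall>w\<in>states M. class_effect M (class_comp M Y X) w = Some w"
      using inverses X by blast
    \<comment> \<open>Both classes fix every state.\<close>
    have "class_comp M Y X = ?e"
      using inv by (intro action_class_eqI class_comp_closed X Y e)
        (simp add: class_effect_class identity_in_actions effect_identity)
    with Y show ?thesis by blast
  qed
  then have "group \<lparr>carrier = action_classes M, mult = class_comp M, one = ?e\<rparr>"
    \<comment> \<open>\<open>groupI\<close> asks for a left unit and left inverses, besides closure
      and associativity.\<close>
    using e by (intro groupI)
      (simp_all add: class_comp_closed class_comp_assoc class_comp_identity_left)
  then show ?thesis by blast
qed

end
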